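(* (Admissibility of $\dagger$-flip.) In the dagger lambda calculus the structural rule $\dagger$-flip is admissible: if $a:A\vdash_S b:B$ is derivable, then $b:B\vdash_{S_*}a:A$ is derivable.
   Context: The dagger lambda calculus. Types are generated from atomic types by $A^*$ and $A\otimes B$, with $(A^* )^*\equiv A$ and $(A\otimes B)^* := B^*\otimes A^*$; one atomic type $I$, with $I\equiv I^*$, acts as tensor unit. Terms are generated from typed variables and typed constants by $t_*$ and $t\otimes u$; if $t:A$ and $u:B$ then $t_*:A^*$ and $t\otimes u:A\otimes B$; $(t_* )_*\equiv t$ and $(t\otimes u)_* := u_*\otimes t_*$. For each type $A$ there is a constant $D_A:I$, with $D_I=1$ and $1=1_*$. A soup connection $t:u$ is an ordered pair of terms of the same type, with the identification $t:u\equiv u_*:t_*$ and negation $(t:u)_* := t_*:u_*\equiv u:t$. A soup is a set of connections $\{v_1:v_2,\dots,v_{m-1}:v_m\}$; $S_*$ negates each connection. A typing judgement (sequent) has the form $t_1:A_1,\dots,t_n:A_n\vdash_S t:B$ with $S$ a soup ($\vdash$ means empty soup). A variable is bound if it occurs twice in the judgement (anywhere, including the soup). $\alpha$-renaming replaces all occurrences of a bound variable by a constant-free term of the same type made of variables not occurring in the judgement, or replaces both occurrences of a bound term (constant-free, all variables bound) occurring twice by a fresh variable of the same type. For $\Delta=t_1:T_1,\dots,t_n:T_n$, $\bigotimes\Delta$ is $((t_1\otimes t_2)\otimes\dots)\otimes t_n:((T_1\otimes T_2)\otimes\dots)\otimes T_n$. Judgements are derived by the following rules. Id: $x:A\vdash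 x:A$. Negation: from $a:A\vdash_S b:B$ infer $a_*:A^*\vdash_{S_*}b_*:B^*$. Cut: from $\Gamma\vdash_{S_1}a:A$ and $a':A,\Delta\vdash_{S_2}b:B$ infer $\Gamma,\Delta\vdash_{S_1\cup S_2\cup\{a:a'\}}b:B$. $\otimes R$: from $\Gamma\vdash_{S_1}a:A$ and $\Delta\vdash_{S_2}b:B$ infer $\Gamma,\bigotimes\Delta\vdash_{S_1\cup S_2}a\otimes b:A\otimes B$. Curry (both directions; the inverse is called Uncurry): $a:A,\Gamma\vdash_S b:B$ iff $\Gamma\vdash_S a_*\otimes b:A^*\otimes B$. $\otimes L$ (both directions): $\Gamma,a:A,b:B\vdash_S c:C$ iff $\Gamma,a\otimes b:A\otimes B\vdash_S c:C$. Exchange: adjacent left-hand terms may be swapped. Unit rules (both directions): $\Gamma\vdash_{S\cup\{i_*:1\}}b:B$ iff $i:I,\Gamma\vdash_S b:B$; and $\Gamma\vdash_{S\cup\{i_*:1\}}b:B$ iff $\Gamma,i:I\vdash_S b:B$. The premises of Cut and $\otimes R$ must share no variables ($\alpha$-rename first if needed). Constants are introduced by $\vdash 1:I$ and, for a constant $f:A^*\otimes B$, by $a:A\vdash_{\{f:a_*\otimes b\}}b:B$. Convention for empty right-hand sides: $a:A,\Gamma\vdash_S$ abbreviates $a:A,\Gamma\vdash_S 1:I$; since $I$ acts as tensor unit, $a_*\otimes 1:A^*\otimes I$ on the right is identified with $a_*:A^*$, so that Curry/Uncurry also take the form: $a:A,\Gamma\vdash_S$ iff $\Gamma\vdash_S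 a_*:A^*$. *)

theory Defs
  imports Main "HOL-Library.FSet"
begin

text \<open>
  Types, terms and connections are taken up to the identifications
  \<open>(A\<^sup>*)\<^sup>* \<equiv> A\<close>, \<open>(A \<otimes> B)\<^sup>* = B\<^sup>* \<otimes> A\<^sup>*\<close>, \<open>I\<^sup>* \<equiv> I\<close> (likewise for terms, with \<open>1\<^sub>* = 1\<close>), and
  \<open>t : u \<equiv> u\<^sub>* : t\<^sub>*\<close>.  For types and terms this is done through normal forms: the star is a
  function that pushes itself down to the leaves, and every leaf comes in a plain and a starred
  version (suffix \<open>S\<close>), except \<open>I\<close> and \<open>1\<close>, which are self-dual.  Connections form a quotient type.
\<close>

datatype 'a ty =
    Unit
  | Atom 'a
  | AtomS 'a
  | TTensor "'a ty" "'a ty"  (infixl \<open>\<otimes>\<close> 70)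

primrec dual :: "'a ty \<Rightarrow> 'a ty" where
  "dual Unit = Unit"
| "dual (Atom p) = AtomS p"
| "dual (AtomS p) = Atom p"
| "dual (A \<otimes> B) = dual B \<otimes> dual A"

lemma dual_dual [simp]: "dual (dual A) = A"
  by (induction A) auto

text \<open>A variable carries its type, so that there are infinitely many variables of each type.\<close>

type_synonym 'a var = "nat \<times> 'a ty"

datatype ('a, 'c) tm =
    Var "'a var"
  | VarS "'a var"
  | Con 'c
  | ConS 'c
  | One
  | Dim "'a ty"
  | DimS "'a ty"
  | Tensor "('a, 'c) tm" "('a, 'c) tm"  (infixl \<open>\<otimes>\<^sub>t\<close> 70)

primrec neg :: "('a, 'c) tm \<Rightarrow> ('a, 'c) tm" where
  "neg (Var x) = VarS x"
| "neg (VarS x) = Var x"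
| "neg (Con f) = ConS f"
| "neg (ConS f) = Con f"
| "neg One = One"
| "neg (Dim A) = DimS A"
| "neg (DimS A) = Dim A"
| "neg (t \<otimes>\<^sub>t u) = neg u \<otimes>\<^sub>t neg t"

lemma neg_neg [simp]: "neg (neg t) = t"
  by (induction t) auto

text \<open>
  The constant \<open>D\<^sub>A\<close>, with \<open>D\<^sub>I = 1\<close>.  The leaves \<open>Dim Unit\<close> and \<open>DimS Unit\<close> are not values of
  \<open>D\<close> or of its negation, and have no type.
\<close>

definition D :: "'a ty \<Rightarrow> ('a, 'c) tm" where
  "D A = (if A = Unit then One else Dim A)"

text \<open>
  \<open>Sg\<close> is the signature: it lists the typed constants other than the \<open>D\<^sub>A\<close>, with their types.
\<close>

inductive has_type :: "('c \<Rightarrow> 'a ty option) \<Rightarrow> ('a, 'c) tm \<Rightarrow> 'a ty \<Rightarrow> bool"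
  for Sg :: "'c \<Rightarrow> 'a ty option" where
  "has_type Sg (Var x) (snd x)"
| "Sg f = Some A \<Longrightarrow> has_type Sg (Con f) A"
| "has_type Sg (D A) Unit"
| "has_type Sg t A \<Longrightarrow> has_type Sg (neg t) (dual A)"
| "has_type Sg t A \<Longrightarrow> has_type Sg u B \<Longrightarrow> has_type Sg (t \<otimes>\<^sub>t u) (A \<otimes> B)"

primrec const_free :: "('a, 'c) tm \<Rightarrow> bool" where
  "const_free (Var x) = True"
| "const_free (VarS x) = True"
| "const_free (Con f) = False"
| "const_free (ConS f) = False"
| "const_free One = False"
| "const_free (Dim A) = False"
| "const_free (DimS A) = False"
| "const_free (t \<otimes>\<^sub>t u) = (const_free t \<and> const_free u)"

text \<open>Number of occurrences of a variable; an occurrence of \<open>x\<^sub>*\<close> is an occurrence of \<open>x\<close>.\<close>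

primrec occ :: "'a var \<Rightarrow> ('a, 'c) tm \<Rightarrow> nat" where
  "occ x (Var y) = (if x = y then 1 else 0)"
| "occ x (VarS y) = (if x = y then 1 else 0)"
| "occ x (Con f) = 0"
| "occ x (ConS f) = 0"
| "occ x One = 0"
| "occ x (Dim A) = 0"
| "occ x (DimS A) = 0"
| "occ x (t \<otimes>\<^sub>t u) = occ x t + occ x u"

primrec subst :: "'a var \<Rightarrow> ('a, 'c) tm \<Rightarrow> ('a, 'c) tm \<Rightarrow> ('a, 'c) tm" where
  "subst x s (Var y) = (if x = y then s else Var y)"
| "subst x s (VarS y) = (if x = y then neg s else VarS y)"
| "subst x s (Con f) = Con f"
| "subst x s (ConS f) = ConS f"
| "subst x s One = One"
| "subst x s (Dim A) = Dim A"
| "subst x s (DimS A) = DimS A"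
| "subst x s (t \<otimes>\<^sub>t u) = subst x s t \<otimes>\<^sub>t subst x s u"

lemma occ_neg [simp]: "occ x (neg t) = occ x t"
  by (induction t) auto

lemma subst_neg [simp]: "subst x s (neg t) = neg (subst x s t)"
  by (induction t) auto

definition conn_eq ::
  "('a, 'c) tm \<times> ('a, 'c) tm \<Rightarrow> ('a, 'c) tm \<times> ('a, 'c) tm \<Rightarrow> bool" where
  "conn_eq p q \<longleftrightarrow> q = p \<or> q = (neg (snd p), neg (fst p))"

quotient_type ('a, 'c) conn = "('a, 'c) tm \<times> ('a, 'c) tm" / conn_eq
  by (rule equivpI) (auto simp: reflp_def symp_def transp_def conn_eq_def)

lift_definition connect :: "('a, 'c) tm \<Rightarrow> ('a, 'c) tm \<Rightarrow> ('a, 'c) conn"  (infix \<open>\<bowtie>\<close> 60)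
  is "\<lambda>t u. (t, u)" .

lift_definition neg_conn :: "('a, 'c) conn \<Rightarrow> ('a, 'c) conn"
  is "\<lambda>(t, u). (neg t, neg u)"
  by (auto simp: conn_eq_def)

lift_definition occ_conn :: "'a var \<Rightarrow> ('a, 'c) conn \<Rightarrow> nat"
  is "\<lambda>x (t, u). occ x t + occ x u"
  by (auto simp: conn_eq_def)

lift_definition subst_conn :: "'a var \<Rightarrow> ('a, 'c) tm \<Rightarrow> ('a, 'c) conn \<Rightarrow> ('a, 'c) conn"
  is "\<lambda>x s (t, u). (subst x s t, subst x s u)"
  by (auto simp: conn_eq_def)

lemma connect_swap: "(t \<bowtie> u) = (neg u \<bowtie> neg t)"
  by transfer (simp add: conn_eq_def)

type_synonym ('a, 'c) soup = "('a, 'c) conn fset"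

definition neg_soup :: "('a, 'c) soup \<Rightarrow> ('a, 'c) soup" where
  "neg_soup S = neg_conn |`| S"

text \<open>The pair \<open>(t, A)\<close> stands for \<open>t : A\<close>.\<close>

type_synonym ('a, 'c) typed_tm = "('a, 'c) tm \<times> 'a ty"

datatype ('a, 'c) judgement =
  Judgement "('a, 'c) typed_tm list" "('a, 'c) soup" "('a, 'c) typed_tm"
    (\<open>(_ \<turnstile>\<^bsub>_\<^esub> _)\<close> [56, 0, 56] 55)

fun occ_jdg :: "'a var \<Rightarrow> ('a, 'c) judgement \<Rightarrow> nat" where
  "occ_jdg x (\<Gamma> \<turnstile>\<^bsub>S\<^esub> r) =
     (\<Sum>(t, A)\<leftarrow>\<Gamma>. occ x t) + (\<Sum>c\<in>fset S. occ_conn x c) + occ x (fst r)"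

fun subst_jdg :: "'a var \<Rightarrow> ('a, 'c) tm \<Rightarrow> ('a, 'c) judgement \<Rightarrow> ('a, 'c) judgement" where
  "subst_jdg x s (\<Gamma> \<turnstile>\<^bsub>S\<^esub> (t, B)) =
     (map (\<lambda>(u, A). (subst x s u, A)) \<Gamma> \<turnstile>\<^bsub>subst_conn x s |`| S\<^esub> (subst x s t, B))"

definition bound :: "'a var \<Rightarrow> ('a, 'c) judgement \<Rightarrow> bool" where
  "bound x J \<longleftrightarrow> occ_jdg x J = 2"

definition no_shared_vars :: "('a, 'c) judgement \<Rightarrow> ('a, 'c) judgement \<Rightarrow> bool" where
  "no_shared_vars J K \<longleftrightarrow> (\<forall>x. occ_jdg x J = 0 \<or> occ_jdg x K = 0)"

text \<open>
  \<open>\<Otimes>\<Delta>\<close>, as a context: a single left-nested tensor if \<open>\<Delta>\<close> is nonempty; the empty \<open>\<Delta>\<close> contributes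
  no left-hand term.
\<close>

fun bigtensor :: "('a, 'c) typed_tm list \<Rightarrow> ('a, 'c) typed_tm list" where
  "bigtensor [] = []"
| "bigtensor (r # \<Delta>) = [foldl (\<lambda>(t, A) (u, B). (t \<otimes>\<^sub>t u, A \<otimes> B)) r \<Delta>]"

text \<open>
  Remarks on the rules below.  Judgements are considered up to \<open>\<alpha>\<close>-renaming, hence the two
  renaming rules.  In \<open>alpha_fold\<close>, \<open>subst_jdg z u J\<close> is the judgement in which the term \<open>u\<close>
  occurs twice and \<open>J\<close> is the result of replacing these occurrences by \<open>z\<close>; that the variables
  of \<open>u\<close> do not occur in \<open>J\<close> says that no occurrence is left.
  In \<open>const\<close> the two terms are distinct variables; \<open>\<alpha>\<close>-renaming turns them into compound terms.
  The pair \<open>unit_rhs\<close>, \<open>unit_rhs_inv\<close> is the identification of \<open>t \<otimes> 1 : A \<otimes> I\<close> with \<open>t : A\<close> on the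
  right-hand side.  An empty right-hand side is \<open>1 : I\<close>, i.e. \<open>(One, Unit)\<close>.
\<close>

inductive derivable :: "('c \<Rightarrow> 'a ty option) \<Rightarrow> ('a, 'c) judgement \<Rightarrow> bool"
    (infix \<open>\<tturnstile>\<close> 50)
  for Sg :: "'c \<Rightarrow> 'a ty option" where
  ident: "Sg \<tturnstile> [(Var x, snd x)] \<turnstile>\<^bsub>{||}\<^esub> (Var x, snd x)"
| negation:
    "Sg \<tturnstile> [(a, A)] \<turnstile>\<^bsub>S\<^esub> (b, B) \<Longrightarrow>
     Sg \<tturnstile> [(neg a, dual A)] \<turnstile>\<^bsub>neg_soup S\<^esub> (neg b, dual B)"
| cut:
    "Sg \<tturnstile> \<Gamma> \<turnstile>\<^bsub>S1\<^esub> (a, A) \<Longrightarrow>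
     Sg \<tturnstile> (a', A) # \<Delta> \<turnstile>\<^bsub>S2\<^esub> (b, B) \<Longrightarrow>
     no_shared_vars (\<Gamma> \<turnstile>\<^bsub>S1\<^esub> (a, A)) ((a', A) # \<Delta> \<turnstile>\<^bsub>S2\<^esub> (b, B)) \<Longrightarrow>
     Sg \<tturnstile> \<Gamma> @ \<Delta> \<turnstile>\<^bsub>S1 |\<union>| S2 |\<union>| {|a \<bowtie> a'|}\<^esub> (b, B)"
| tensor_right:
    "Sg \<tturnstile> \<Gamma> \<turnstile>\<^bsub>S1\<^esub> (a, A) \<Longrightarrow>
     Sg \<tturnstile> \<Delta> \<turnstile>\<^bsub>S2\<^esub> (b, B) \<Longrightarrow>
     no_shared_vars (\<Gamma> \<turnstile>\<^bsub>S1\<^esub> (a, A)) (\<Delta> \<turnstile>\<^bsub>S2\<^esub> (b, B)) \<Longrightarrow>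
     Sg \<tturnstile> \<Gamma> @ bigtensor \<Delta> \<turnstile>\<^bsub>S1 |\<union>| S2\<^esub> (a \<otimes>\<^sub>t b, A \<otimes> B)"
| curry:
    "Sg \<tturnstile> (a, A) # \<Gamma> \<turnstile>\<^bsub>S\<^esub> (b, B) \<Longrightarrow>
     Sg \<tturnstile> \<Gamma> \<turnstile>\<^bsub>S\<^esub> (neg a \<otimes>\<^sub>t b, dual A \<otimes> B)"
| uncurry:
    "Sg \<tturnstile> \<Gamma> \<turnstile>\<^bsub>S\<^esub> (neg a \<otimes>\<^sub>t b, dual A \<otimes> B) \<Longrightarrow>
     Sg \<tturnstile> (a, A) # \<Gamma> \<turnstile>\<^bsub>S\<^esub> (b, B)"
| tensor_left:
    "Sg \<tturnstile> \<Gamma> @ [(a, A), (b, B)] \<turnstile>\<^bsub>S\<^esub> (c, C) \<Longrightarrow>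
     Sg \<tturnstile> \<Gamma> @ [(a \<otimes>\<^sub>t b, A \<otimes> B)] \<turnstile>\<^bsub>S\<^esub> (c, C)"
| tensor_left_inv:
    "Sg \<tturnstile> \<Gamma> @ [(a \<otimes>\<^sub>t b, A \<otimes> B)] \<turnstile>\<^bsub>S\<^esub> (c, C) \<Longrightarrow>
     Sg \<tturnstile> \<Gamma> @ [(a, A), (b, B)] \<turnstile>\<^bsub>S\<^esub> (c, C)"
| exchange:
    "Sg \<tturnstile> \<Gamma> @ [(a, A), (b, B)] @ \<Delta> \<turnstile>\<^bsub>S\<^esub> (c, C) \<Longrightarrow>
     Sg \<tturnstile> \<Gamma> @ [(b, B), (a, A)] @ \<Delta> \<turnstile>\<^bsub>S\<^esub> (c, C)"
| unit_left:
    "has_type Sg i Unit \<Longrightarrow>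
     Sg \<tturnstile> \<Gamma> \<turnstile>\<^bsub>S |\<union>| {|neg i \<bowtie> One|}\<^esub> (b, B) \<Longrightarrow>
     Sg \<tturnstile> (i, Unit) # \<Gamma> \<turnstile>\<^bsub>S\<^esub> (b, B)"
| unit_left_inv:
    "Sg \<tturnstile> (i, Unit) # \<Gamma> \<turnstile>\<^bsub>S\<^esub> (b, B) \<Longrightarrow>
     Sg \<tturnstile> \<Gamma> \<turnstile>\<^bsub>S |\<union>| {|neg i \<bowtie> One|}\<^esub> (b, B)"
| unit_right:
    "has_type Sg i Unit \<Longrightarrow>
     Sg \<tturnstile> \<Gamma> \<turnstile>\<^bsub>S |\<union>| {|neg i \<bowtie> One|}\<^esub> (b, B) \<Longrightarrow>
     Sg \<tturnstile> \<Gamma> @ [(i, Unit)] \<turnstile>\<^bsub>S\<^esub> (b, B)"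
| unit_right_inv:
    "Sg \<tturnstile> \<Gamma> @ [(i, Unit)] \<turnstile>\<^bsub>S\<^esub> (b, B) \<Longrightarrow>
     Sg \<tturnstile> \<Gamma> \<turnstile>\<^bsub>S |\<union>| {|neg i \<bowtie> One|}\<^esub> (b, B)"
| one: "Sg \<tturnstile> [] \<turnstile>\<^bsub>{||}\<^esub> (One, Unit)"
| const:
    "Sg f = Some (dual A \<otimes> B) \<Longrightarrow> (m, A) \<noteq> (n, B) \<Longrightarrow>
     Sg \<tturnstile> [(Var (m, A), A)]
           \<turnstile>\<^bsub>{|Con f \<bowtie> (neg (Var (m, A)) \<otimes>\<^sub>t Var (n, B))|}\<^esub> (Var (n, B), B)"
| unit_rhs:
    "Sg \<tturnstile> \<Gamma> \<turnstile>\<^bsub>S\<^esub> (t \<otimes>\<^sub>t One, A \<otimes> Unit) \<Longrightarrow> Sg \<tturnstile> \<Gamma> \<turnstile>\<^bsub>S\<^esub> (t, A)"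
| unit_rhs_inv:
    "Sg \<tturnstile> \<Gamma> \<turnstile>\<^bsub>S\<^esub> (t, A) \<Longrightarrow> Sg \<tturnstile> \<Gamma> \<turnstile>\<^bsub>S\<^esub> (t \<otimes>\<^sub>t One, A \<otimes> Unit)"
| alpha_unfold:
    "Sg \<tturnstile> J \<Longrightarrow> bound x J \<Longrightarrow> const_free u \<Longrightarrow> has_type Sg u (snd x) \<Longrightarrow>
     (\<And>y. occ y u > 0 \<Longrightarrow> occ_jdg y J = 0) \<Longrightarrow>
     Sg \<tturnstile> subst_jdg x u J"
| alpha_fold:
    "Sg \<tturnstile> subst_jdg z u J \<Longrightarrow> const_free u \<Longrightarrow> has_type Sg u (snd z) \<Longrightarrow>
     (\<And>y. occ y u > 0 \<Longrightarrow> bound y (subst_jdg z u J)) \<Longrightarrow>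
     occ_jdg z (subst_jdg z u J) = 0 \<Longrightarrow> bound z J \<Longrightarrow>
     (\<And>y. occ y u > 0 \<Longrightarrow> occ_jdg y J = 0) \<Longrightarrow>
     Sg \<tturnstile> J"

end

(* Currying moves both sides of the sequent into one term on the right; uncurrying that term against
   the unit moves it to the left, as b_* tensor a. The negation rule turns this single term into
   a_* tensor b, and splitting it and currying back only a_* leaves b on the left and a on the right. *)

theory Submission
  imports Defs
begin

theorem theorem2p2:
  fixes Sg :: "'c \<Rightarrow> 'a ty option"
    and a b :: "('a, 'c) tm"
    and A B :: "'a ty"
    and S :: "('a, 'c) soup"
  assumes "Sg \<tturnstile> [(a, A)] \<turnstile>\<^bsub>S\<^esub> (b, B)"
  shows "Sg \<tturnstile> [(b, B)] \<turnstile>\<^bsub>neg_soup S\<^esub> (a, A)"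
proof -
  \<comment> \<open>The added \<open>One\<close> lets \<open>uncurry\<close> take the whole of
    \<open>neg a \<otimes>\<^sub>t b\<close> as its first factor.\<close>
  have "Sg \<tturnstile> [] \<turnstile>\<^bsub>S\<^esub> (neg a \<otimes>\<^sub>t b \<otimes>\<^sub>t One, dual A \<otimes> B \<otimes> Unit)"
    using assms by (intro unit_rhs_inv curry)
  then have "Sg \<tturnstile> [(neg b \<otimes>\<^sub>t a, dual B \<otimes> A)] \<turnstile>\<^bsub>S\<^esub> (One, Unit)"
    \<comment> \<open>\<open>neg\<close> reverses tensors, so
      \<open>neg a \<otimes>\<^sub>t b\<close> is
      \<open>neg (neg b \<otimes>\<^sub>t a)\<close>.\<close>
    by (intro uncurry) simp
  from negation[OF this]
  \<comment> \<open>The right side stays empty because \<open>One\<close> and \<open>Unit\<close>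
    are self-dual; \<open>[] @\<close> exposes the context \<Gamma> of
    \<open>tensor_left_inv\<close>.\<close>
  have "Sg \<tturnstile> [] @ [(neg a \<otimes>\<^sub>t b, dual A \<otimes> B)] \<turnstile>\<^bsub>neg_soup S\<^esub> (One, Unit)"
    by simp
  from tensor_left_inv[OF this]
  have "Sg \<tturnstile> [(neg a, dual A), (b, B)] \<turnstile>\<^bsub>neg_soup S\<^esub> (One, Unit)"
    by simp
  \<comment> \<open>Currying stars \<open>neg a\<close> once more, and the double star cancels to
    \<open>a\<close>.\<close>
  from curry[OF this] have "Sg \<tturnstile> [(b, B)] \<turnstile>\<^bsub>neg_soup S\<^esub> (a \<otimes>\<^sub>t One, A \<otimes> Unit)"
    by simp
  then show ?thesis
    by (rule unit_rhs)
qed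

end
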